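(* Let $k\geq 1$ and $d\geq 1$ be integers and let $c$ be an integer with $c\geq (2k-1)\lceil d/2\rceil+1$. If $D$ is a $c$-edge-connected directed graph with diameter $d$, then $D$ is $k$-edge-ordered.
   Context: Directed graphs are finite, without loops or multiple arcs. The diameter is the maximum, over ordered pairs $(u,v)$ of vertices, of the length of a shortest directed path from $u$ to $v$. An edge cut of $D$ is the set $[S,\bar S]$ of arcs from $S$ to its complement $\bar S$, for a nonempty proper subset $S$ of the vertices; $D$ is $c$-edge-connected if every edge cut has at least $c$ arcs. A directed tour is a closed directed walk with no repeated arcs. $D$ is $k$-edge-ordered if for every sequence $e_1,\ldots,e_k$ of $k$ distinct arcs of $D$ there is a directed tour containing $e_1,\ldots,e_k$ in this (cyclic) order. *)

theory Defs
  imports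
    "Graph_Theory.Arc_Walk"
    "HOL-Library.Extended_Nat"
    "HOL-Library.Sublist"
begin

text \<open>
  Finite directed graphs without loops or multiple arcs are the locale \<open>digraph\<close>;
  directed paths are \<open>apath\<close>, whose length is the number of arcs.
\<close>

context pre_digraph
begin

text \<open>The distance is \<open>\<infinity>\<close> if there is no directed path from \<open>u\<close> to \<open>v\<close>.\<close>

definition distance :: "'a \<Rightarrow> 'a \<Rightarrow> enat" where
  "distance u v = (INF p \<in> {p. apath u p v}. enat (length p))"

text \<open>
  For a finite nonempty vertex set the supremum is a maximum; it is \<open>\<infinity>\<close> unless the
  digraph is strongly connected.  For the empty digraph it is \<open>0\<close>.
\<close>

definition diameter :: enat where
  "diameter = (SUP (u, v) \<in> verts G \<times> verts G. distance u v)"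

definition edge_cut :: "'a set \<Rightarrow> 'b set" where
  "edge_cut S = {e \<in> arcs G. tail G e \<in> S \<and> head G e \<in> verts G - S}"

definition edge_connected :: "nat \<Rightarrow> bool" where
  "edge_connected c \<longleftrightarrow> (\<forall>S. S \<noteq> {} \<and> S \<subset> verts G \<longrightarrow> c \<le> card (edge_cut S))"

definition tour :: "'b awalk \<Rightarrow> bool" where
  "tour p \<longleftrightarrow> (\<exists>u. trail u p u)"

text \<open>
  A tour has no distinguished starting vertex, so the prescribed arcs have to occur as a
  (not necessarily contiguous) subsequence of some rotation of its arc list.
\<close>

definition edge_ordered :: "nat \<Rightarrow> bool" where
  "edge_ordered k \<longleftrightarrow>
     (\<forall>es. length es = k \<and> distinct es \<and> set es \<subseteq> arcs G \<longrightarrow>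
        (\<exists>p. tour p \<and> (\<exists>r. subseq es (rotate r p))))"

end

end

theory Submission
  imports Defs "HOL-Library.Disjoint_Sets"
begin

text \<open>
  The bound on \<open>c\<close> is at least \<open>2 * k\<close>, so deleting the \<open>k\<close> prescribed arcs leaves a
  \<open>k\<close>-edge-connected digraph.  Such a digraph is weakly \<open>k\<close>-linked (Shiloach): by Edmonds'
  branching theorem there are \<open>k\<close> arc-disjoint spanning branchings with arbitrarily prescribed
  roots, and the branching rooted at the head of one prescribed arc contains a path to the tail
  of the next one.  Edmonds' theorem is proved by Lovasz' uncrossing argument, in the form
  where each branching starts from a prescribed set of vertices.
\<close>

section \<open>Submodularity of entering arcs and supermodularity of missed root sets\<close>

context pre_digraph
begin

text \<open>The arc set is a parameter because the branching argument uses up arcs one at a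
  time.\<close>

definition entering :: "'b set \<Rightarrow> 'a set \<Rightarrow> 'b set" where
  "entering A X = {e \<in> A. tail G e \<notin> X \<and> head G e \<in> X}"

text \<open>An arc entering \<open>X \<inter> Y\<close> or \<open>X \<union> Y\<close> enters
  \<open>X\<close> or \<open>Y\<close>. An arc entering both has its tail outside the union and its
  head in the intersection, so it enters both \<open>X\<close> and \<open>Y\<close>.\<close>

lemma card_entering_submodular:
  assumes "finite A"
  shows "card (entering A (X \<inter> Y)) + card (entering A (X \<union> Y))
    \<le> card (entering A X) + card (entering A Y)"
proof -
  have fin: "finite (entering A Z)" for Z
    using assms by (simp add: entering_def)
  have "card (entering A (X \<inter> Y)) + card (entering A (X \<union> Y))
      = card (entering A (X \<inter> Y) \<union> entering A (X \<union> Y))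
        + card (entering A (X \<inter> Y) \<inter> entering A (X \<union> Y))"
    by (rule card_Un_Int[OF fin fin])
  also have "\<dots> \<le> card (entering A X \<union> entering A Y) + card (entering A X \<inter> entering A Y)"
    by (intro add_mono card_mono) (auto simp: fin, auto simp: entering_def)
  also have "\<dots> = card (entering A X) + card (entering A Y)"
    by (rule card_Un_Int[OF fin fin, symmetric])
  finally show ?thesis .
qed

end

text \<open>This is the demand of \<open>X\<close> in Edmonds' condition: every branching whose root
  set avoids \<open>X\<close> needs its own arc entering \<open>X\<close>.\<close>

definition missed :: "'i set \<Rightarrow> ('i \<Rightarrow> 'a set) \<Rightarrow> 'a set \<Rightarrow> 'i set" where
  "missed I R X = {i \<in> I. R i \<inter> X = {}}"

lemma finite_missed: "finite I \<Longrightarrow> finite (missed I R X)"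
  by (simp add: missed_def)

lemma card_missed_supermodular:
  assumes "finite I"
  shows "card (missed I R X) + card (missed I R Y)
    \<le> card (missed I R (X \<inter> Y)) + card (missed I R (X \<union> Y))"
proof -
  note fin = finite_missed[OF assms]
  have "card (missed I R X) + card (missed I R Y)
      = card (missed I R X \<union> missed I R Y) + card (missed I R X \<inter> missed I R Y)"
    by (rule card_Un_Int[OF fin fin])
  also have "\<dots> \<le> card (missed I R (X \<inter> Y)) + card (missed I R (X \<union> Y))"
    by (intro add_mono card_mono fin) (auto simp: missed_def)
  finally show ?thesis .
qed

text \<open>The index \<open>j\<close> is missed by the intersection but by neither \<open>X\<close>
  nor \<open>Y\<close>, which makes one of the two inclusions behind supermodularity proper.\<close>

lemma card_missed_supermodular_strict:
  assumes "finite I" "j \<in> I" "R j \<inter> X \<noteq> {}" "R j \<inter> Y \<noteq> {}" "R j \<inter> (X \<inter> Y) = {}"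
  shows "card (missed I R X) + card (missed I R Y)
    < card (missed I R (X \<inter> Y)) + card (missed I R (X \<union> Y))"
proof -
  note fin = finite_missed[OF assms(1)]
  have "card (missed I R X) + card (missed I R Y)
      = card (missed I R X \<union> missed I R Y) + card (missed I R X \<inter> missed I R Y)"
    by (rule card_Un_Int[OF fin fin])
  also have "\<dots> < card (missed I R (X \<inter> Y)) + card (missed I R (X \<union> Y))"
  proof (rule add_less_le_mono)
    have "j \<in> missed I R (X \<inter> Y)" "j \<notin> missed I R X \<union> missed I R Y"
      using assms by (auto simp: missed_def)
    moreover have "missed I R X \<union> missed I R Y \<subseteq> missed I R (X \<inter> Y)"
      by (auto simp: missed_def)
    ultimately show "card (missed I R X \<union> missed I R Y) < card (missed I R (X \<inter> Y))"
      by (intro psubset_card_mono fin) blast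
    show "card (missed I R X \<inter> missed I R Y) \<le> card (missed I R (X \<union> Y))"
      by (intro card_mono fin) (auto simp: missed_def)
  qed
  finally show ?thesis .
qed

section \<open>Edmonds' branching theorem and arc-disjoint linkages\<close>

context fin_digraph
begin

text \<open>Growing root set \<open>j\<close> along \<open>e\<close> can break the cut condition
  only at a tight set that \<open>e\<close> enters and that already meets \<open>R j\<close>.
  Choosing \<open>e\<close> inside a minimal tight set that meets \<open>R j\<close> without being
  contained in it excludes this by uncrossing.\<close>

lemma branching_extension_arc:
  assumes "finite I" "j \<in> I" "A \<subseteq> arcs G"
    and R: "\<And>i. i \<in> I \<Longrightarrow> R i \<noteq> {} \<and> R i \<subseteq> verts G"
    and cut: "\<And>X. X \<noteq> {} \<Longrightarrow> X \<subseteq> verts G \<Longrightarrow> card (missed I R X) \<le> card (entering A X)"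
    and "R j \<noteq> verts G"
  obtains e where "e \<in> A" "tail G e \<in> R j" "head G e \<notin> R j"
    "\<forall>X. X \<noteq> {} \<longrightarrow> X \<subseteq> verts G \<longrightarrow>
      card (missed I (R(j := insert (head G e) (R j))) X) \<le> card (entering (A - {e}) X)"
proof -
  have finA: "finite A"
    using \<open>A \<subseteq> arcs G\<close> finite_arcs finite_subset by blast
  have finE: "finite (entering A X)" for X
    using finA by (simp add: entering_def)
  define tight where "tight X \<longleftrightarrow> card (missed I R X) = card (entering A X)" for X
  define \<T> where "\<T> = {X. X \<subseteq> verts G \<and> tight X \<and> X \<inter> R j \<noteq> {} \<and> X - R j \<noteq> {}}"
  \<comment> \<open>The whole vertex set has demand 0 and no entering arcs, so \<open>\<T>\<close>
    is nonempty and has a minimal member.\<close>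
  have "entering A (verts G) = {}" "missed I R (verts G) = {}"
    using R \<open>A \<subseteq> arcs G\<close> by (auto simp: entering_def missed_def)
  then have "verts G \<in> \<T>"
    using R[OF \<open>j \<in> I\<close>] \<open>R j \<noteq> verts G\<close> by (auto simp: \<T>_def tight_def)
  moreover have "finite \<T>"
    by (rule finite_subset[of _ "Pow (verts G)"]) (auto simp: \<T>_def)
  ultimately obtain X where X: "X \<in> \<T>" and Xmin: "\<And>Y. Y \<in> \<T> \<Longrightarrow> Y \<subseteq> X \<Longrightarrow> X = Y"
    using finite_has_minimal[of \<T>] by blast
  \<comment> \<open>Removing \<open>R j\<close> from the tight set \<open>X\<close> adds
    \<open>j\<close> to the demand. Hence more arcs enter \<open>X - R j\<close> than
    \<open>X\<close>, and one that does not enter \<open>X\<close> must have its tail in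
    \<open>X \<inter> R j\<close>.\<close>
  have "card (entering A X) = card (missed I R X)"
    using X by (simp add: \<T>_def tight_def)
  also have "\<dots> < card (missed I R (X - R j))"
  proof (rule psubset_card_mono[OF finite_missed[OF \<open>finite I\<close>]])
    have "j \<in> missed I R (X - R j)" "j \<notin> missed I R X"
      using X \<open>j \<in> I\<close> by (auto simp: missed_def \<T>_def)
    then show "missed I R X \<subset> missed I R (X - R j)"
      by (auto simp: missed_def)
  qed
  also have "\<dots> \<le> card (entering A (X - R j))"
    using X by (intro cut) (auto simp: \<T>_def)
  finally have "\<not> entering A (X - R j) \<subseteq> entering A X"
    using card_mono[OF finE] by (meson not_le)
  then obtain e where e: "e \<in> A" "tail G e \<in> X" "tail G e \<in> R j" "head G e \<in> X" "head G e \<notin> R j"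
    by (auto simp: entering_def)
  show ?thesis
  proof (rule that[OF e(1,3,5)], intro allI impI)
    fix Y assume Y: "Y \<noteq> {}" "Y \<subseteq> verts G"
    let ?R = "R(j := insert (head G e) (R j))"
    have sub: "missed I ?R Y \<subseteq> missed I R Y"
      by (auto simp: missed_def split: if_splits)
    then have le: "card (missed I ?R Y) \<le> card (missed I R Y)"
      by (intro card_mono finite_missed \<open>finite I\<close>)
    show "card (missed I ?R Y) \<le> card (entering (A - {e}) Y)"
    proof (cases "e \<in> entering A Y")
      case False
      then have "entering (A - {e}) Y = entering A Y"
        by (auto simp: entering_def)
      then show ?thesis
        using le cut[OF Y] by simp
    next
      case True
      have "entering (A - {e}) Y = entering A Y - {e}"
        by (auto simp: entering_def)
      then have card_eq: "card (entering (A - {e}) Y) = card (entering A Y) - 1"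
        using True finE by simp
      have eY: "tail G e \<notin> Y" "head G e \<in> Y"
        using True by (auto simp: entering_def)
      show ?thesis
      proof (cases "R j \<inter> Y = {}")
        case True
        \<comment> \<open>The head of \<open>e\<close> puts a new root into \<open>Y\<close>, so the
          demand drops along with the supply.\<close>
        then have "j \<in> missed I R Y" "j \<notin> missed I ?R Y"
          using eY \<open>j \<in> I\<close> by (auto simp: missed_def)
        then have "card (missed I ?R Y) < card (missed I R Y)"
          using sub by (intro psubset_card_mono finite_missed \<open>finite I\<close>) blast
        then show ?thesis
          using cut[OF Y] card_eq by linarith
      next
        case False
        \<comment> \<open>If \<open>Y\<close> were tight, equality would hold throughout the
          uncrossing inequalities, so \<open>X \<inter> Y\<close> would be tight and, by the strict
          version, would meet \<open>R j\<close>. It contains the head of \<open>e\<close> but not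
          its tail, so it would be a smaller member of \<open>\<T>\<close> than
          \<open>X\<close>.\<close>
        have "\<not> tight Y"
        proof
          assume "tight Y"
          have XY: "card (missed I R (X \<inter> Y)) \<le> card (entering A (X \<inter> Y))"
            "card (missed I R (X \<union> Y)) \<le> card (entering A (X \<union> Y))"
            using X Y e eY by (auto intro!: cut simp: \<T>_def)
          have sum: "card (entering A (X \<inter> Y)) + card (entering A (X \<union> Y))
              \<le> card (missed I R X) + card (missed I R Y)"
            using card_entering_submodular[OF finA, of X Y] X \<open>tight Y\<close>
            by (simp add: \<T>_def tight_def)
          have "R j \<inter> X \<noteq> {}"
            using X by (auto simp: \<T>_def)
          then have "R j \<inter> (X \<inter> Y) \<noteq> {}"
            using card_missed_supermodular_strict[OF \<open>finite I\<close> \<open>j \<in> I\<close>, of R X Y] False XY sum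
            by linarith
          moreover have "tight (X \<inter> Y)"
            using card_missed_supermodular[OF \<open>finite I\<close>, of R X Y] XY sum
            unfolding tight_def by linarith
          ultimately have "X \<inter> Y \<in> \<T>"
            using Y e eY by (auto simp: \<T>_def)
          then show False
            using Xmin[of "X \<inter> Y"] e eY by blast
        qed
        then show ?thesis
          using cut[OF Y] le card_eq unfolding tight_def by linarith
      qed
    qed
  qed
qed

text \<open>Root sets instead of single roots let the induction absorb a chosen arc:
  \<open>R i\<close> is what branching \<open>i\<close> has reached so far, and the number of
  vertices still to be reached, summed over \<open>i\<close>, decreases.\<close>

theorem arc_disjoint_branchings:
  assumes "finite I" "A \<subseteq> arcs G"
    and "\<And>i. i \<in> I \<Longrightarrow> R i \<noteq> {} \<and> R i \<subseteq> verts G"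
    and "\<And>X. X \<noteq> {} \<Longrightarrow> X \<subseteq> verts G \<Longrightarrow> card (missed I R X) \<le> card (entering A X)"
  shows "\<exists>F. (\<forall>i\<in>I. F i \<subseteq> A) \<and> disjoint_family_on F I \<and>
    (\<forall>i\<in>I. \<forall>v\<in>verts G. \<exists>u\<in>R i. \<exists>p. awalk u p v \<and> set p \<subseteq> F i)"
  using assms
proof (induction "\<Sum>i\<in>I. card (verts G - R i)" arbitrary: R A rule: less_induct)
  case less
  note R = less.prems(3) and cut = less.prems(4)
  show ?case
  proof (cases "\<forall>i\<in>I. R i = verts G")
    case True
    then have "\<forall>i\<in>I. \<forall>v\<in>verts G. \<exists>u\<in>R i. \<exists>p. awalk u p v \<and> set p \<subseteq> {}"
      by (metis awalk_Nil_iff empty_subsetI list.set(1))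
    then show ?thesis
      by (intro exI[of _ "\<lambda>_. {}"]) (simp add: disjoint_family_on_def)
  next
    case False
    then obtain j where j: "j \<in> I" "R j \<noteq> verts G"
      by blast
    obtain e where e: "e \<in> A" "tail G e \<in> R j" "head G e \<notin> R j"
      and cut': "\<forall>X. X \<noteq> {} \<longrightarrow> X \<subseteq> verts G \<longrightarrow>
        card (missed I (R(j := insert (head G e) (R j))) X) \<le> card (entering (A - {e}) X)"
      by (rule branching_extension_arc[OF less.prems(1) j(1) less.prems(2) R cut j(2)])
    let ?R = "R(j := insert (head G e) (R j))"
    have eG: "e \<in> arcs G"
      using e less.prems by blast
    have dec: "(\<Sum>i\<in>I. card (verts G - ?R i)) < (\<Sum>i\<in>I. card (verts G - R i))"
    proof (rule sum_strict_mono_ex1[OF less.prems(1)])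
      show "\<forall>i\<in>I. card (verts G - ?R i) \<le> card (verts G - R i)"
        by (intro ballI card_mono) auto
      have "head G e \<in> verts G - R j" "head G e \<notin> verts G - ?R j"
        using e eG by simp_all
      then have "verts G - ?R j \<subset> verts G - R j"
        by auto
      then show "\<exists>i\<in>I. card (verts G - ?R i) < card (verts G - R i)"
        using j by (intro bexI[of _ j] psubset_card_mono) simp_all
    qed
    have R': "?R i \<noteq> {} \<and> ?R i \<subseteq> verts G" if "i \<in> I" for i
      using R[OF that] eG by (cases "i = j") auto
    have A': "A - {e} \<subseteq> arcs G"
      using less.prems(2) by blast
    have "\<exists>F. (\<forall>i\<in>I. F i \<subseteq> A - {e}) \<and> disjoint_family_on F I \<and>
        (\<forall>i\<in>I. \<forall>v\<in>verts G. \<exists>u\<in>?R i. \<exists>p. awalk u p v \<and> set p \<subseteq> F i)"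
      by (rule less.hyps[OF dec less.prems(1) A' R' cut'[rule_format]])
    then obtain F where F: "\<forall>i\<in>I. F i \<subseteq> A - {e}" "disjoint_family_on F I"
      and reach: "\<forall>i\<in>I. \<forall>v\<in>verts G. \<exists>u\<in>?R i. \<exists>p. awalk u p v \<and> set p \<subseteq> F i"
      by blast
    \<comment> \<open>The arc \<open>e\<close> goes back to branching \<open>j\<close>: a walk from
      the extra root, the head of \<open>e\<close>, is prolonged by \<open>e\<close> to start in
      \<open>R j\<close>. Disjointness survives because every \<open>F i\<close> lies in
      \<open>A - {e}\<close>.\<close>
    let ?F = "F(j := insert e (F j))"
    have "\<exists>u\<in>R i. \<exists>p. awalk u p v \<and> set p \<subseteq> ?F i" if iv: "i \<in> I" "v \<in> verts G" for i v
    proof -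
      obtain u p where p: "u \<in> ?R i" "awalk u p v" "set p \<subseteq> F i"
        using reach iv by blast
      show ?thesis
      proof (cases "u \<in> R i")
        case True
        then show ?thesis
          using p by (intro bexI[of _ u] exI[of _ p]) auto
      next
        case False
        then have "i = j" "u = head G e"
          using p by (auto split: if_splits)
        then show ?thesis
          using p e eG by (intro bexI[of _ "tail G e"] exI[of _ "e # p"]) (auto simp: awalk_Cons_iff)
      qed
    qed
    moreover have "\<forall>i\<in>I. ?F i \<subseteq> A"
      using F e by auto
    moreover have "disjoint_family_on ?F I"
      unfolding disjoint_family_on_def
    proof (intro ballI impI)
      fix m n assume mn: "m \<in> I" "n \<in> I" "m \<noteq> n"
      then have "F m \<inter> F n = {}" "e \<notin> F m" "e \<notin> F n"
        using F by (auto simp: disjoint_family_on_def)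
      then show "?F m \<inter> ?F n = {}"
        using mn by (cases "m = j"; cases "n = j") simp_all
    qed
    ultimately show ?thesis
      by (intro exI[of _ ?F]) blast
  qed
qed

text \<open>With singleton root sets no demand exceeds \<open>card I\<close>, so Edmonds' theorem
  applies, and the branching rooted at \<open>s i\<close> reaches \<open>t i\<close> in
  particular.\<close>

lemma arc_disjoint_linkage:
  assumes "finite I" "A \<subseteq> arcs G"
    and "\<And>i. i \<in> I \<Longrightarrow> s i \<in> verts G" "\<And>i. i \<in> I \<Longrightarrow> t i \<in> verts G"
    and cut: "\<And>X. X \<noteq> {} \<Longrightarrow> X \<subset> verts G \<Longrightarrow> card I \<le> card (entering A X)"
  obtains P where "\<forall>i\<in>I. trail (s i) (P i) (t i)" "\<forall>i\<in>I. set (P i) \<subseteq> A"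
    "disjoint_family_on (\<lambda>i. set (P i)) I"
proof -
  have "card (missed I (\<lambda>i. {s i}) X) \<le> card (entering A X)" if "X \<noteq> {}" "X \<subseteq> verts G" for X
  proof (cases "X = verts G")
    case True
    then have "missed I (\<lambda>i. {s i}) X = {}"
      using assms by (auto simp: missed_def)
    then show ?thesis
      by simp
  next
    case False
    have "card (missed I (\<lambda>i. {s i}) X) \<le> card I"
      by (intro card_mono assms) (auto simp: missed_def)
    then show ?thesis
      using cut[of X] False that by fastforce
  qed
  then obtain F where F: "\<forall>i\<in>I. F i \<subseteq> A" "disjoint_family_on F I"
    and reach: "\<forall>i\<in>I. \<forall>v\<in>verts G. \<exists>u\<in>{s i}. \<exists>p. awalk u p v \<and> set p \<subseteq> F i"
    using arc_disjoint_branchings[OF assms(1,2), of "\<lambda>i. {s i}"] assms(3) by auto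
  have "\<exists>p. trail (s i) p (t i) \<and> set p \<subseteq> F i" if i: "i \<in> I" for i
  proof -
    obtain p where p: "awalk (s i) p (t i)" "set p \<subseteq> F i"
      using reach i assms(4) by blast
    \<comment> \<open>Shortcutting cycles removes repeated arcs and introduces no new ones.\<close>
    have "trail (s i) (awalk_to_apath p) (t i)"
      using apath_awalk_to_apath[OF p(1)] by (auto simp: apath_def trail_def dest: distinct_verts_imp_distinct)
    then show ?thesis
      using awalk_to_apath_subset[OF p(1)] p(2) by blast
  qed
  then obtain P where P: "\<And>i. i \<in> I \<Longrightarrow> trail (s i) (P i) (t i) \<and> set (P i) \<subseteq> F i"
    by metis
  show ?thesis
  proof (rule that)
    show "disjoint_family_on (\<lambda>i. set (P i)) I"
      unfolding disjoint_family_on_def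
    proof (intro ballI impI)
      fix m n assume "m \<in> I" "n \<in> I" "m \<noteq> n"
      then have "F m \<inter> F n = {}" "set (P m) \<subseteq> F m" "set (P n) \<subseteq> F n"
        using P F(2) by (simp_all add: disjoint_family_on_def)
      then show "set (P m) \<inter> set (P n) = {}"
        by blast
    qed
    show "\<forall>i\<in>I. set (P i) \<subseteq> A"
      using P F(1) by (meson subset_trans)
  qed (simp add: P)
qed

section \<open>Tours through prescribed arcs\<close>

theorem edge_connected_imp_edge_ordered:
  assumes "edge_connected c" "2 * k \<le> c" "k \<ge> 1"
  shows "edge_ordered k"
  unfolding edge_ordered_def
proof (intro allI impI)
  fix es assume es: "length es = k \<and> distinct es \<and> set es \<subseteq> arcs G"
  define A where "A = arcs G - set es"
  have es_arc: "es ! (i mod k) \<in> arcs G" for i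
    using es \<open>k \<ge> 1\<close> by (metis less_eq_Suc_le mod_less_divisor nth_mem One_nat_def subsetD)
  have cut: "card {..<k} \<le> card (entering A X)" if "X \<noteq> {}" "X \<subset> verts G" for X
  proof -
    \<comment> \<open>\<open>edge_cut\<close> counts arcs leaving a set, so it is applied to the
      complement of \<open>X\<close>. Of these at least \<open>2 * k\<close> arcs, at most
      \<open>k\<close> are prescribed.\<close>
    have "c \<le> card (edge_cut (verts G - X))"
      using assms(1) that unfolding edge_connected_def by (metis Diff_eq_empty_iff Diff_subset
          double_diff order_refl psubsetE psubsetI Diff_empty)
    moreover have "edge_cut (verts G - X) - set es = entering A X"
      using that by (auto simp: edge_cut_def entering_def A_def)
    moreover have "card (edge_cut (verts G - X)) - card (set es) \<le> card (edge_cut (verts G - X) - set es)"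
      by (rule diff_card_le_card_Diff) simp
    ultimately show ?thesis
      using es assms(2) by (simp add: distinct_card)
  qed
  have A: "A \<subseteq> arcs G"
    by (auto simp: A_def)
  \<comment> \<open>The index modulo \<open>k\<close> makes the last trail lead back to the first
    prescribed arc.\<close>
  obtain P where "\<forall>i\<in>{..<k}. trail (head G (es ! (i mod k))) (P i) (tail G (es ! (Suc i mod k)))"
    and "\<forall>i\<in>{..<k}. set (P i) \<subseteq> A" and disj: "disjoint_family_on (\<lambda>i. set (P i)) {..<k}"
    using arc_disjoint_linkage[of "{..<k}" A "\<lambda>i. head G (es ! (i mod k))"
        "\<lambda>i. tail G (es ! (Suc i mod k))",
        OF finite_lessThan A head_in_verts[OF es_arc] tail_in_verts[OF es_arc] cut]
    by blast
  then have P: "trail (head G (es ! (i mod k))) (P i) (tail G (es ! (Suc i mod k)))"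
    and PA: "set (P i) \<subseteq> A" if "i < k" for i
    using that by blast+
  \<comment> \<open>The prescribed arcs in order, each followed by the trail from its head to the
    tail of the next one.\<close>
  define W where "W n = concat (map (\<lambda>i. es ! i # P i) [0..<n])" for n
  have W_Suc: "W (Suc n) = W n @ es ! n # P n" for n
    by (simp add: W_def)
  have set_W: "set (W n) = (\<Union>i<n. insert (es ! i) (set (P i)))" for n
    by (auto simp: W_def)
  have "awalk (tail G (es ! 0)) (W n) (tail G (es ! (n mod k))) \<and> distinct (W n)
      \<and> subseq (take n es) (W n)" if "n \<le> k" for n
    using that
  proof (induction n)
    case 0
    then show ?case
      using es_arc[of 0] by (simp add: W_def awalk_Nil_iff)
  next
    case (Suc n)
    then have n: "n < k" "n mod k = n"
      by auto
    have "awalk (tail G (es ! n)) (es ! n # P n) (tail G (es ! (Suc n mod k)))"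
      using P[OF n(1)] es_arc[of n] n by (auto simp: awalk_Cons_iff trail_def)
    then have walk: "awalk (tail G (es ! 0)) (W (Suc n)) (tail G (es ! (Suc n mod k)))"
      using Suc n unfolding W_Suc by (auto intro: awalk_appendI)
    \<comment> \<open>The trails avoid all prescribed arcs because they lie in \<open>A\<close>.
      Together with disjointness of the trails, this keeps the arcs of \<open>W\<close>
      distinct.\<close>
    have esP: "es ! n \<notin> set (P i)" if "i \<le> n" for i
      using PA[of i] that n es by (auto simp: A_def)
    have "insert (es ! i) (set (P i)) \<inter> insert (es ! n) (set (P n)) = {}" if "i < n" for i
    proof -
      have "es ! i \<notin> set (P n)" "es ! i \<noteq> es ! n"
        using PA[of n] that n es by (auto simp: A_def nth_eq_iff_index_eq)
      moreover have "set (P i) \<inter> set (P n) = {}"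
        using disj that n by (simp add: disjoint_family_on_def)
      ultimately show ?thesis
        using esP[of i] that by simp
    qed
    then have "set (W n) \<inter> set (es ! n # P n) = {}"
      unfolding set_W by (simp only: list.set) blast
    moreover have "distinct (es ! n # P n)"
      using P[OF n(1)] esP[of n] by (simp add: trail_def)
    ultimately have "distinct (W (Suc n))"
      using Suc n unfolding W_Suc by (simp only: distinct_append)
    moreover have "subseq (take n es @ [es ! n]) (W n @ es ! n # P n)"
      using Suc by (intro list_emb_append_mono) auto
    then have "subseq (take (Suc n) es) (W (Suc n))"
      using es n by (simp add: take_Suc_conv_app_nth W_Suc)
    ultimately show ?case
      using walk by blast
  qed
  from this[of k] have "tour (W k)" "subseq es (rotate 0 (W k))"
    using es by (auto simp: tour_def trail_def)
  then show "\<exists>p. tour p \<and> (\<exists>r. subseq es (rotate r p))"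
    by blast
qed

end

theorem theorem7p1:
  fixes D :: "('a, 'b) pre_digraph" and k d c :: nat
  assumes "k \<ge> 1" and "d \<ge> 1"
    and "int c \<ge> (2 * int k - 1) * \<lceil>real d / 2\<rceil> + 1"
    and "digraph D"
    and "pre_digraph.edge_connected D c"
    and "pre_digraph.diameter D = enat d"
  shows "pre_digraph.edge_ordered D k"
proof -
  interpret digraph D by fact
  \<comment> \<open>With the ceiling at least 1, the bound gives \<open>c\<close> at least
    \<open>(2 * k - 1) + 1 = 2 * k\<close>.\<close>
  have "1 \<le> \<lceil>real d / 2\<rceil>"
    using \<open>d \<ge> 1\<close> by (simp add: one_le_ceiling)
  then have "(2 * int k - 1) * 1 \<le> (2 * int k - 1) * \<lceil>real d / 2\<rceil>"
    using \<open>k \<ge> 1\<close> by (intro mult_left_mono) auto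
  then have "int (2 * k) \<le> int c"
    using assms(3) by simp
  then have "2 * k \<le> c"
    by (simp only: of_nat_le_iff)
  then show ?thesis
    using edge_connected_imp_edge_ordered assms by blast
qed

end
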